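(* Let $(f_\ell)_{\ell\in\mathbb N}$ be an admissible sequence of weight functions (as defined in the context) and let $S\subseteq\mathbb N$ with complement $E=\mathbb N\setminus S$. Assume $1,3\in S$ and $2,4\in E$. Let $n\ge 4$ be an integer with $n\not\equiv 1\pmod 3$. Then for all sufficiently large $\ell$ (depending on $n$): $\Delta_{E,\ell}(n)>0$ if $n\equiv 0\pmod 3$, and $\Delta_{E,\ell}(n)<0$ if $n\equiv 2\pmod 3$.
   Context: $\mathbb N=\{1,2,3,\dots\}$. An admissible sequence of weight functions is a sequence $(f_\ell)_{\ell\in\mathbb N}$ of functions $f_\ell:\mathbb N\to\mathbb N$ with $f_\ell(1)=1$ for all $\ell$ and $f_1\equiv 1$, for which there exist real-valued functions $\Phi,\Psi$ on $\mathbb N$ such that: (1) $n^{\Phi(\ell)}\le f_\ell(n)\le n^{\Psi(\ell)}$ for all $\ell,n\in\mathbb N$; (2) there is a positive number $B$ independent of $\ell$ with $0\le\Psi(\ell)-\Phi(\ell)\le B$ for all $\ell$; (3) $\lim_{\ell\to\infty}\Phi(\ell)=\infty$. For $S\subseteq\mathbb N$ with $1\in S$ and $E=\mathbb N\setminus S$ (the exception set), the numbers $p_{E,\ell}(n)$ are defined by the formal power series identity $\sum_{n=0}^\infty p_{E,\ell}(n)q^n=\prod_{n\in S}(1-q^n)^{-f_\ell(n)}$, and $\Delta_{E,\ell}(n):=p_{E,\ell}(n)^2-p_{E,\ell}(n-1)\,p_{E,\ell}(n+1)$ for $n\ge1$. *)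

theory Defs
  imports "HOL-Analysis.Infinite_Products" "HOL-Computational_Algebra.Formal_Power_Series"
begin

text \<open>
  Throughout, the positive integers are rendered as the naturals that are at least 1;
  values of the weight functions at index 0 or argument 0 are irrelevant.
\<close>

definition admissible_weights :: "(nat \<Rightarrow> nat \<Rightarrow> nat) \<Rightarrow> bool" where
  "admissible_weights f \<longleftrightarrow>
     (\<forall>l\<ge>1. \<forall>n\<ge>1. f l n \<ge> 1) \<and>
     (\<forall>l\<ge>1. f l 1 = 1) \<and>
     (\<forall>n\<ge>1. f 1 n = 1) \<and>
     (\<exists>\<Phi> \<Psi> :: nat \<Rightarrow> real.
        (\<forall>l\<ge>1. \<forall>n\<ge>1. real n powr \<Phi> l \<le> real (f l n) \<and> real (f l n) \<le> real n powr \<Psi> l) \<and>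
        (\<exists>B>0. \<forall>l\<ge>1. 0 \<le> \<Psi> l - \<Phi> l \<and> \<Psi> l - \<Phi> l \<le> B) \<and>
        filterlim \<Phi> at_top sequentially)"

text \<open>
  The product over the positive integers outside \<open>E\<close>, as an infinite product in the ring of
  formal power series with its usual (coefficientwise) topology. The index is shifted by one, so
  that the factor with number \<open>k\<close> belongs to the integer \<open>k + 1\<close>.
\<close>

definition gf_factor :: "nat set \<Rightarrow> (nat \<Rightarrow> nat) \<Rightarrow> nat \<Rightarrow> real fps" where
  "gf_factor E w m = (if m \<in> E then 1 else inverse ((1 - fps_X ^ m) ^ w m))"

definition partition_gf :: "nat set \<Rightarrow> (nat \<Rightarrow> nat) \<Rightarrow> real fps" where
  "partition_gf E w = (\<Prod>k. gf_factor E w (Suc k))"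

definition p_restricted :: "(nat \<Rightarrow> nat \<Rightarrow> nat) \<Rightarrow> nat set \<Rightarrow> nat \<Rightarrow> nat \<Rightarrow> real" where
  "p_restricted f E l n = fps_nth (partition_gf E (f l)) n"

definition Delta :: "(nat \<Rightarrow> nat \<Rightarrow> nat) \<Rightarrow> nat set \<Rightarrow> nat \<Rightarrow> nat \<Rightarrow> real" where
  "Delta f E l n =
     (p_restricted f E l n)\<^sup>2 - p_restricted f E l (n - 1) * p_restricted f E l (n + 1)"

text \<open>The infinite product always converges, so \<^const>\<open>partition_gf\<close> is its genuine value.\<close>

lemma fps_pow_nth_below:
  fixes a b :: "real fps"
  assumes "\<And>j. j < m \<Longrightarrow> fps_nth a j = fps_nth 1 j" and "i < m"
  shows "fps_nth (b * a) i = fps_nth b i"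
proof -
  have "fps_nth (b * a) i = fps_nth (b * 1) i"
    unfolding fps_mult_nth using assms by (intro sum.cong) auto
  then show ?thesis by simp
qed

lemma gf_factor_nth_below:
  assumes "m \<ge> 1" "j < m"
  shows "fps_nth (gf_factor E w m) j = fps_nth 1 j"
proof (cases "m \<in> E")
  case False
  let ?d = "(1 - fps_X ^ m) :: real fps"
  have d: "fps_nth ?d i = fps_nth 1 i" if "i < m" for i
    using that by (simp add: fps_X_power_iff)
  have pow: "fps_nth (?d ^ r) i = fps_nth 1 i" if "i < m" for i r
    using that
  proof (induction r arbitrary: i)
    case (Suc r)
    have "fps_nth (?d ^ r * ?d) i = fps_nth (?d ^ r) i"
      by (rule fps_pow_nth_below[OF d Suc.prems])
    then show ?case using Suc by (simp add: mult.commute)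
  qed simp
  have "fps_nth (?d ^ w m) 0 \<noteq> 0" using pow[of 0] assms by simp
  then have "inverse (?d ^ w m) * ?d ^ w m = 1" by (rule inverse_mult_eq_1)
  then have "fps_nth (inverse (?d ^ w m)) j = fps_nth 1 j"
    using fps_pow_nth_below[of m "?d ^ w m" j "inverse (?d ^ w m)"] pow assms by simp
  then show ?thesis using False by (simp add: gf_factor_def)
qed (simp add: gf_factor_def)

lemma prod_gf_factor_stable:
  assumes "n \<le> N"
  shows "fps_nth (\<Prod>k\<le>N. gf_factor E w (Suc k)) n = fps_nth (\<Prod>k\<le>n. gf_factor E w (Suc k)) n"
  using assms
proof (induction N rule: dec_induct)
  case (step N)
  have "fps_nth (prod (\<lambda>k. gf_factor E w (Suc k)) {..N} * gf_factor E w (Suc (Suc N))) n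
      = fps_nth (prod (\<lambda>k. gf_factor E w (Suc k)) {..N}) n"
    by (rule fps_pow_nth_below[OF gf_factor_nth_below]) (use step in auto)
  then show ?case using step by simp
qed simp

lemma has_prod_partition_gf:
  "(\<lambda>k. gf_factor E w (Suc k)) has_prod partition_gf E w"
proof -
  define P where "P = Abs_fps (\<lambda>n. fps_nth (\<Prod>k\<le>n. gf_factor E w (Suc k)) n)"
  have lim: "(\<lambda>N. \<Prod>k\<le>N. gf_factor E w (Suc k)) \<longlonglongrightarrow> P"
    unfolding tendsto_fps_iff
    by (auto simp: P_def eventually_sequentially intro!: exI prod_gf_factor_stable)
  have "fps_nth P 0 = 1" using gf_factor_nth_below[of 1 0 E w] by (simp add: P_def)
  then have "P \<noteq> 0" by auto
  with lim have "(\<lambda>k. gf_factor E w (Suc k)) has_prod P"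
    by (simp add: has_prod_def raw_has_prod_def)
  then show ?thesis
    unfolding partition_gf_def using has_prod_unique by metis
qed

lemma p_restricted_eq_finite_prod:
  assumes "n \<le> N"
  shows "p_restricted f E l n = fps_nth (\<Prod>k\<le>N. gf_factor E (f l) (Suc k)) n"
proof -
  let ?F = "\<lambda>k. gf_factor E (f l) (Suc k)"
  have "fps_nth (?F k) 0 = 1" for k
    using gf_factor_nth_below[of "Suc k" 0 E "f l"] by simp
  then have "?F k \<noteq> 0" for k
    by (metis fps_zero_nth zero_neq_one)
  then have "(\<lambda>N. prod ?F {..N}) \<longlonglongrightarrow> partition_gf E (f l)"
    using has_prod_partition_gf[of E "f l"] by (auto simp: has_prod_def raw_has_prod_def)
  then have "\<forall>\<^sub>F M in sequentially. fps_nth (prod ?F {..M}) n = p_restricted f E l n"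
    unfolding tendsto_fps_iff p_restricted_def by auto
  then obtain M where "M \<ge> n" "fps_nth (prod ?F {..M}) n = p_restricted f E l n"
    unfolding eventually_sequentially using nat_le_linear by blast
  then show ?thesis using prod_gf_factor_stable assms by metis
qed

end

theory Submission
  imports Defs "HOL-Computational_Algebra.Formal_Laurent_Series"
begin

unbundle no vec_syntax
unbundle fps_syntax

text \<open>
  The coefficient \<open>p(n)\<close> is a sum over the partitions of \<open>n\<close> into parts from \<open>S\<close>, and a partition
  contributes roughly (product of its parts) to the power \<open>\<Phi> l\<close>. Hence the largest product
  of parts wins as \<open>l\<close> grows. When the parts 2 and 4 are forbidden, the maximal product is \<open>3^k\<close> for
  \<open>n = 3k\<close> and \<open>n = 3k + 1\<close>, and it is at most \<open>(5/3) * 3^k\<close> for \<open>n = 3k + 2\<close>. The two claims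
  then amount to \<open>5/9 < 1\<close> and \<open>25/9 < 3\<close>.
\<close>

section \<open>The largest product of parts\<close>

text \<open>For remainder 2 and \<open>n \<ge> 5\<close> this is the product of one 5 and otherwise
  threes. At \<open>n = 2\<close> the value 5/3 exceeds the true maximum 1, which keeps a single
  formula; the function serves only in upper bounds.\<close>

definition max_part_prod :: "nat \<Rightarrow> real" where
  "max_part_prod n = (if n mod 3 = 2 then 5/3 else 1) * 3 ^ (n div 3)"

lemma max_part_prod_ge_1: "max_part_prod n \<ge> 1"
proof -
  have "(1::real) \<le> 3 ^ (n div 3)" by simp
  then have "1 \<le> 5 / 3 * (3::real) ^ (n div 3)" by linarith
  then show ?thesis by (simp add: max_part_prod_def)
qed

lemma max_part_prod_eq:
  "max_part_prod (3 * k) = 3 ^ k"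
  "max_part_prod (3 * k + 1) = 3 ^ k"
  "max_part_prod (3 * k + 2) = 5/3 * 3 ^ k"
proof -
  have "(3 * k + 1) div 3 = k" "(3 * k + 1) mod 3 = 1" "(3 * k + 2) div 3 = k" "(3 * k + 2) mod 3 = 2"
    by presburger+
  then show "max_part_prod (3 * k) = 3 ^ k" "max_part_prod (3 * k + 1) = 3 ^ k"
    "max_part_prod (3 * k + 2) = 5/3 * 3 ^ k"
    by (simp_all only: max_part_prod_def) simp_all
qed

text \<open>Once both arguments are split by their remainders mod 3, the factor
  \<open>3 ^ i * 3 ^ j\<close> cancels and nine numerical inequalities remain. The critical one, for
  remainders 2 and 2, is 25/9 \<le> 3.\<close>

lemma max_part_prod_supermult: "max_part_prod a * max_part_prod b \<le> max_part_prod (a + b)"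
proof -
  define i j where "i = a div 3" and "j = b div 3"
  have "a = 3 * i \<or> a = 3 * i + 1 \<or> a = 3 * i + 2" "b = 3 * j \<or> b = 3 * j + 1 \<or> b = 3 * j + 2"
    unfolding i_def j_def by presburger+
  moreover have "3 * i + 3 * j = 3 * (i + j)" "3 * i + (3 * j + 1) = 3 * (i + j) + 1"
    "3 * i + (3 * j + 2) = 3 * (i + j) + 2" "3 * i + 1 + 3 * j = 3 * (i + j) + 1"
    "3 * i + 1 + (3 * j + 1) = 3 * (i + j) + 2" "3 * i + 1 + (3 * j + 2) = 3 * (i + j + 1)"
    "3 * i + 2 + 3 * j = 3 * (i + j) + 2" "3 * i + 2 + (3 * j + 1) = 3 * (i + j + 1)"
    "3 * i + 2 + (3 * j + 2) = 3 * (i + j + 1) + 1"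
    by simp_all
  moreover have "(0::real) < 3 ^ i * 3 ^ j" by simp
  ultimately show ?thesis
    by (elim disjE) (simp_all only: max_part_prod_eq power_add, simp_all)
qed

text \<open>This is where the exclusion of the parts 2 and 4 enters: the bound fails there, since 2
  > 5/3 and 4 > 3. For large \<open>m\<close>, splitting off a 3 does not decrease the product, as m
  \<le> 3 (m - 3).\<close>

lemma le_max_part_prod:
  assumes "m \<noteq> 2" "m \<noteq> 4"
  shows "real m \<le> max_part_prod m"
  using assms
proof (induction m rule: less_induct)
  case (less m)
  show ?case
  \<comment> \<open>From 8 on, \<open>m - 3\<close> is at least 5 and so avoids the excluded values
    2 and 4.\<close>
  proof (cases "m \<ge> 8")
    case True
    have "real (m - 3) \<le> max_part_prod (m - 3)" using True by (intro less.IH) auto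
    moreover have "max_part_prod 3 * max_part_prod (m - 3) \<le> max_part_prod (3 + (m - 3))"
      by (rule max_part_prod_supermult)
    ultimately show ?thesis using True by (simp add: max_part_prod_def[of 3] of_nat_diff)
  next
    case False
    then have "m \<in> {0, 1, 3, 5, 6, 7}" using less.prems by auto
    then show ?thesis by (auto simp: max_part_prod_def)
  qed
qed

lemma max_part_prod_power: "max_part_prod m ^ j \<le> max_part_prod (m * j)"
proof (induction j)
  case (Suc j)
  have "max_part_prod m * max_part_prod m ^ j \<le> max_part_prod m * max_part_prod (m * j)"
    using Suc max_part_prod_ge_1[of m] by (intro mult_left_mono) auto
  also have "\<dots> \<le> max_part_prod (m + m * j)" by (rule max_part_prod_supermult)
  finally show ?case by simp
qed (simp add: max_part_prod_def)

section \<open>Coefficients of products of power series\<close>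

text \<open>Supermultiplicativity makes the bound survive convolution: each term of the Cauchy
  product is controlled by \<open>H i * H (j - i) \<le> H j\<close>, and there are at most
  \<open>n + 1\<close> terms. Each further factor therefore costs only
  \<open>(n + 1) * K\<close>.\<close>

lemma fps_prod_nth_bound:
  fixes F :: "'i \<Rightarrow> real fps" and H :: "nat \<Rightarrow> real"
  assumes "finite I" and H: "\<And>j. H j \<ge> 1" and HH: "\<And>i j. H i * H j \<le> H (i + j)" and K: "K \<ge> 1"
    and F: "\<And>i j. i \<in> I \<Longrightarrow> j \<le> n \<Longrightarrow> 0 \<le> F i $ j \<and> F i $ j \<le> K * H j"
    and "j \<le> n"
  shows "0 \<le> (\<Prod>i\<in>I. F i) $ j \<and> (\<Prod>i\<in>I. F i) $ j \<le> (real (n + 1) * K) ^ card I * H j"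
  using \<open>finite I\<close> F \<open>j \<le> n\<close>
proof (induction I arbitrary: j rule: finite_induct)
  case empty
  have "0 \<le> H j" using H[of j] by linarith
  then show ?case using H[of 0] by (auto simp: fps_one_nth)
next
  case (insert x I)
  define C where "C = (real (n + 1) * K) ^ card I"
  have C: "C \<ge> 0" using K by (simp add: C_def)
  have H0: "H j \<ge> 0" for j using H[of j] by linarith
  have IH: "0 \<le> (\<Prod>i\<in>I. F i) $ j \<and> (\<Prod>i\<in>I. F i) $ j \<le> C * H j" if "j \<le> n" for j
    using insert.IH[OF _ that] insert.prems(1) by (simp add: C_def)
  have eq: "(\<Prod>i\<in>insert x I. F i) $ j = (\<Sum>i=0..j. F x $ i * (\<Prod>i\<in>I. F i) $ (j - i))"
    using insert.hyps by (simp add: fps_mult_nth)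
  have "F x $ i * (\<Prod>i\<in>I. F i) $ (j - i) \<le> K * C * H j" if "i \<in> {0..j}" for i
  proof -
    have "F x $ i * (\<Prod>i\<in>I. F i) $ (j - i) \<le> (K * H i) * (C * H (j - i))"
      using insert.prems(1)[of x i] IH[of "j - i"] that insert.prems(2) K H0[of i]
      by (intro mult_mono) auto
    also have "\<dots> = K * C * (H i * H (j - i))" by simp
    also have "\<dots> \<le> K * C * H j"
      using HH[of i "j - i"] that K C by (intro mult_left_mono) auto
    finally show ?thesis .
  qed
  then have "(\<Sum>i=0..j. F x $ i * (\<Prod>i\<in>I. F i) $ (j - i)) \<le> of_nat (card {0..j}) * (K * C * H j)"
    by (rule sum_bounded_above)
  then have "(\<Prod>i\<in>insert x I. F i) $ j \<le> real (j + 1) * (K * C * H j)"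
    unfolding eq by simp
  also have "\<dots> \<le> real (n + 1) * (K * C * H j)"
    using insert.prems(2) K C H0[of j] by (intro mult_right_mono) auto
  also have "\<dots> = (real (n + 1) * K) ^ card (insert x I) * H j"
    using insert.hyps by (simp add: C_def)
  finally have "(\<Prod>i\<in>insert x I. F i) $ j \<le> \<dots>" .
  moreover have "0 \<le> (\<Prod>i\<in>insert x I. F i) $ j"
    unfolding eq using insert.prems IH by (intro sum_nonneg mult_nonneg_nonneg) auto
  ultimately show ?case by blast
qed

lemma fps_mult_nth_ge:
  fixes A B :: "real fps"
  assumes "\<And>j. A $ j \<ge> 0" "\<And>j. B $ j \<ge> 0"
  shows "A $ i * B $ j \<le> (A * B) $ (i + j)"
proof -
  have "A $ i * B $ (i + j - i) \<le> (\<Sum>k=0..i+j. A $ k * B $ (i + j - k))"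
    using assms by (intro member_le_sum) auto
  then show ?thesis by (simp add: fps_mult_nth)
qed

lemma fps_prod_nth_nonneg:
  fixes F :: "'i \<Rightarrow> real fps"
  assumes "\<And>i j. i \<in> I \<Longrightarrow> F i $ j \<ge> 0"
  shows "(\<Prod>i\<in>I. F i) $ j \<ge> 0"
  using assms
  by (induction I arbitrary: j rule: infinite_finite_induct)
     (auto simp: fps_one_nth fps_mult_nth intro!: sum_nonneg)

section \<open>Coefficients of a single factor\<close>

text \<open>The negative binomial series with \<open>fps_X ^ m\<close> substituted for the variable.
  The binomial coefficient counts the multisets of \<open>j div m\<close> copies of the part
  \<open>m\<close>, each in one of \<open>w m\<close> colours.\<close>

lemma gf_factor_nth:
  assumes "m \<ge> 1" "m \<notin> E" "w m \<ge> 1"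
  shows "gf_factor E w m $ j = (if m dvd j then real ((w m + j div m - 1) choose (j div m)) else 0)"
proof -
  have X0: "(fps_X ^ m :: real fps) $ 0 = 0" using assms by simp
  have "gf_factor E w m = inverse ((1 - fps_X) ^ w m) oo fps_X ^ m"
    using assms X0
    by (simp add: gf_factor_def fps_inverse_compose fps_compose_power[symmetric] fps_compose_sub_distrib)
  then show ?thesis
    using assms one_minus_const_fps_X_neg_power'[of "w m" "1 :: real"]
    by (simp add: fps_nth_compose_X_power)
qed

lemma gf_factor_nth_nonneg:
  assumes "m \<ge> 1"
  shows "gf_factor E w m $ j \<ge> 0"
  using gf_factor_nth[OF assms, of E w j]
  by (cases "m \<in> E"; cases "w m = 0") (auto simp: gf_factor_def fps_one_nth)

text \<open>For \<open>j = m * k\<close> the coefficient is at most \<open>(k * w m) ^ k\<close>.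
  Here \<open>k ^ k\<close> is absorbed by \<open>n ^ n\<close>, a constant independent of the
  weights, while \<open>w m ^ k\<close> is at most the power \<open>\<psi>\<close> of
  \<open>m ^ k\<close>, the product of \<open>k\<close> parts \<open>m\<close> with sum
  \<open>j\<close>.\<close>

lemma gf_factor_nth_le:
  assumes m: "m \<ge> 1" and E: "2 \<in> E" "4 \<in> E" and \<psi>: "\<psi> \<ge> 0"
    and w: "w m \<ge> 1" "real (w m) \<le> real m powr \<psi>" and j: "j \<le> n"
  shows "gf_factor E w m $ j \<le> real (n ^ n) * max_part_prod j powr \<psi>"
proof -
  have nn: "real (n ^ n) \<ge> 1" by (cases "n = 0") auto
  have H1: "max_part_prod i powr \<psi> \<ge> 1" for i
    using max_part_prod_ge_1 \<psi> by (simp add: ge_one_powr_ge_zero)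
  have big: "1 \<le> real (n ^ n) * max_part_prod j powr \<psi>"
    using mult_mono[OF nn H1[of j]] nn by simp
  show ?thesis
  proof (cases "m \<in> E \<or> \<not> m dvd j")
    case True
    have "gf_factor E w m $ j \<le> 1"
    proof (cases "m \<in> E")
      case False
      then show ?thesis using True gf_factor_nth[of m E w j] m w by simp
    qed (simp add: gf_factor_def fps_one_nth)
    then show ?thesis using big by linarith
  next
    case False
    then obtain k where k: "j = m * k" and mE: "m \<notin> E" by auto
    have "k \<le> n" using j k m by (metis dual_order.trans mult_le_mono1 mult_1)
    have "m \<noteq> 2" "m \<noteq> 4" using mE E by auto
    then have mM: "real m \<le> max_part_prod m" by (rule le_max_part_prod)
    have "(w m + k - 1) choose k \<le> (w m + k - 1) ^ k"
      using w(1) by (intro binomial_le_pow) auto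
    \<comment> \<open>For \<open>k = Suc i\<close> the bases compare as w m + i \<le> w m + i * w m;
      for \<open>k = 0\<close> both powers are 1.\<close>
    also have "\<dots> \<le> (k * w m) ^ k"
    proof (cases k)
      case (Suc i)
      have "i * 1 \<le> i * w m" using w(1) by (intro mult_left_mono) auto
      then show ?thesis using Suc by (intro power_mono) auto
    qed simp
    also have "\<dots> = k ^ k * w m ^ k" by (rule power_mult_distrib)
    also have "\<dots> \<le> n ^ n * w m ^ k"
    proof (cases "n = 0")
      case False
      have "k ^ k \<le> n ^ k" using \<open>k \<le> n\<close> by (simp add: power_mono)
      also have "\<dots> \<le> n ^ n" using \<open>k \<le> n\<close> False by (intro power_increasing) auto
      finally show ?thesis by simp
    qed (use \<open>k \<le> n\<close> in simp)
    finally have "real ((w m + k - 1) choose k) \<le> real (n ^ n * w m ^ k)"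
      by (rule of_nat_mono)
    also have "\<dots> = real (n ^ n) * real (w m) ^ k" by simp
    also have "real (n ^ n) * real (w m) ^ k \<le> real (n ^ n) * max_part_prod j powr \<psi>"
    proof (rule mult_left_mono)
      have "real (w m) ^ k \<le> (max_part_prod m powr \<psi>) ^ k"
        using w(2) powr_mono2[OF \<psi> _ mM] by (intro power_mono) auto
      also have "\<dots> = (max_part_prod m ^ k) powr \<psi>"
        using max_part_prod_ge_1[of m]
        by (induction k) (auto simp: powr_mult)
      also have "\<dots> \<le> max_part_prod j powr \<psi>"
        using max_part_prod_power[of m k] max_part_prod_ge_1[of m] \<psi> k
        by (intro powr_mono2) auto
      finally show "real (w m) ^ k \<le> max_part_prod j powr \<psi>" .
    qed simp
    finally show ?thesis using k m mE w by (simp add: gf_factor_nth)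
  qed
qed

section \<open>Upper and lower bounds for the partition numbers\<close>

text \<open>The function \<open>max_part_prod j powr \<psi>\<close> inherits supermultiplicativity,
  so \<open>fps_prod_nth_bound\<close> applies to the \<open>n + 1\<close> factors that are kept.
  The constant in front depends on \<open>n\<close> alone, not on \<open>l\<close>.\<close>

lemma p_restricted_le:
  assumes E: "2 \<in> E" "4 \<in> E" and \<psi>: "\<psi> \<ge> 0"
    and f: "\<And>m. m \<ge> 1 \<Longrightarrow> f l m \<ge> 1 \<and> real (f l m) \<le> real m powr \<psi>"
  shows "p_restricted f E l n
    \<le> (real (n + 1) * real (n ^ n)) ^ (n + 1) * max_part_prod n powr \<psi>"
proof -
  have "max_part_prod j powr \<psi> \<ge> 1" for j
    using max_part_prod_ge_1 \<psi> by (simp add: ge_one_powr_ge_zero)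
  moreover have "max_part_prod i powr \<psi> * max_part_prod j powr \<psi> \<le> max_part_prod (i + j) powr \<psi>"
    for i j
    using max_part_prod_supermult[of i j] max_part_prod_ge_1[of i] max_part_prod_ge_1[of j] \<psi>
    by (simp flip: powr_mult add: powr_mono2)
  moreover have "real (n ^ n) \<ge> 1" by (cases "n = 0") auto
  moreover have "0 \<le> gf_factor E (f l) (Suc i) $ j \<and>
      gf_factor E (f l) (Suc i) $ j \<le> real (n ^ n) * max_part_prod j powr \<psi>" if "j \<le> n" for i j
    using gf_factor_nth_le[of "Suc i" E \<psi> "f l" j n] f[of "Suc i"] E \<psi> that
      gf_factor_nth_nonneg[of "Suc i"] by auto
  ultimately have "(\<Prod>k\<in>{..n}. gf_factor E (f l) (Suc k)) $ n
      \<le> (real (n + 1) * real (n ^ n)) ^ card {..n} * max_part_prod n powr \<psi>"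
    using fps_prod_nth_bound[of "{..n}" "\<lambda>j. max_part_prod j powr \<psi>" "real (n ^ n)" n
        "\<lambda>k. gf_factor E (f l) (Suc k)" n]
    by blast
  then show ?thesis by (simp add: p_restricted_eq_finite_prod[OF order_refl])
qed

lemma p_restricted_nonneg: "p_restricted f E l n \<ge> 0"
  unfolding p_restricted_eq_finite_prod[OF order_refl]
  by (intro fps_prod_nth_nonneg gf_factor_nth_nonneg) simp

text \<open>Only the partitions into \<open>k\<close> coloured threes and \<open>r\<close> ones are
  kept. The factor of 3 contributes a binomial coefficient, the factor of 1 contributes 1, and all
  others enter through their constant term 1.\<close>

lemma p_restricted_ge:
  assumes E: "1 \<notin> E" "3 \<notin> E" and f: "f l 1 = 1" "f l 3 \<ge> 1"
  shows "real (f l 3) ^ k / real (k ^ k) \<le> p_restricted f E l (3 * k + r)"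
proof -
  define F where "F = (\<lambda>i. gf_factor E (f l) (Suc i))"
  \<comment> \<open>Index \<open>i\<close> stands for the integer \<open>i + 1\<close>, so 0 and 2
    are the parts 1 and 3. The summand 2 keeps both in range even for
    \<open>k = r = 0\<close>.\<close>
  define I where "I = {..3 * k + r + 2} - {0, 2}"
  have F0: "F i $ j \<ge> 0" for i j
    unfolding F_def by (rule gf_factor_nth_nonneg) simp
  have R0: "prod F I $ j \<ge> 0" for j by (rule fps_prod_nth_nonneg) (rule F0)
  have "{..3 * k + r + 2} = insert 2 (insert 0 I)" by (auto simp: I_def)
  moreover have "0 \<notin> I" "2 \<notin> insert 0 I" "finite I" by (auto simp: I_def)
  ultimately have split: "prod F {..3 * k + r + 2} = F 2 * (F 0 * prod F I)" by simp
  have "F i $ 0 = 1" for i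
    using gf_factor_nth_below[of "Suc i" 0 E "f l"] by (simp add: F_def)
  then have "prod F I $ 0 = 1"
    by (induction I rule: infinite_finite_induct) auto
  moreover have "F 0 $ r = 1"
    using gf_factor_nth[of 1 E "f l" r] E f by (simp add: F_def)
  ultimately have Q: "1 \<le> (F 0 * prod F I) $ r"
    using fps_mult_nth_ge[of "F 0" "prod F I" r 0] F0 R0 by simp
  have Q0: "(F 0 * prod F I) $ j \<ge> 0" for j
    using F0 R0 by (auto simp: fps_mult_nth intro!: sum_nonneg)
  have "real (f l 3) ^ k / real (k ^ k) = (real (f l 3) / real k) ^ k"
    by (simp add: power_divide)
  \<comment> \<open>For \<open>k = 0\<close> the quotients are 0 by convention, and both zeroth
    powers are 1.\<close>
  also have "\<dots> \<le> (real (f l 3 + k - 1) / real k) ^ k"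
    using f by (cases k) (simp, intro power_mono divide_right_mono, auto)
  also have "\<dots> \<le> real ((f l 3 + k - 1) choose k)"
    using f by (intro binomial_ge_n_over_k_pow_k) auto
  also have "\<dots> = F 2 $ (3 * k)"
    using gf_factor_nth[of 3 E "f l" "3 * k"] E f by (simp add: F_def flip: numeral_3_eq_3)
  also have "\<dots> \<le> F 2 $ (3 * k) * (F 0 * prod F I) $ r"
    using mult_left_mono[OF Q F0[of 2 "3 * k"]] by simp
  also have "\<dots> \<le> prod F {..3 * k + r + 2} $ (3 * k + r)"
    unfolding split by (rule fps_mult_nth_ge) (rule F0 Q0)+
  also have "\<dots> = p_restricted f E l (3 * k + r)"
    using p_restricted_eq_finite_prod[of "3 * k + r" "3 * k + r + 2" f E l] by (simp add: F_def)
  finally show ?thesis .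
qed

section \<open>Comparison for large \<open>l\<close>\<close>

text \<open>A strictly larger base beats all constants. Replacing \<open>\<Psi> l\<close> by
  \<open>B + \<Phi> l\<close> costs the fixed factor \<open>a powr B\<close>, and
  \<open>(a / b) powr \<Phi> l\<close> tends to 0.\<close>

lemma eventually_powr_less:
  fixes \<Phi> \<Psi> :: "nat \<Rightarrow> real"
  assumes ab: "1 \<le> a" "a < b" and c: "0 < c" and C: "0 \<le> C"
    and B: "\<forall>\<^sub>F l in sequentially. \<Psi> l - \<Phi> l \<le> B" and lim: "filterlim \<Phi> at_top sequentially"
  shows "\<forall>\<^sub>F l in sequentially. C * a powr \<Psi> l < c * b powr \<Phi> l"
proof -
  have "ln (a / b) < 0" using ab by simp
  then have "filterlim (\<lambda>l. ln (a / b) * \<Phi> l) at_bot sequentially"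
    using lim by (rule filterlim_tendsto_neg_mult_at_bot[OF tendsto_const])
  then have "(\<lambda>l. exp (ln (a / b) * \<Phi> l)) \<longlonglongrightarrow> 0"
    by (rule filterlim_compose[OF exp_at_bot])
  then have "(\<lambda>l. (a / b) powr \<Phi> l) \<longlonglongrightarrow> 0"
    using ab by (simp add: powr_def mult.commute)
  then have "(\<lambda>l. C * a powr B * (a / b) powr \<Phi> l) \<longlonglongrightarrow> 0"
    by (rule tendsto_mult_right_zero)
  then have "\<forall>\<^sub>F l in sequentially. C * a powr B * (a / b) powr \<Phi> l < c"
    using c by (rule order_tendstoD)
  with B show ?thesis
  proof eventually_elim
    case (elim l)
    have "a powr \<Psi> l \<le> a powr (B + \<Phi> l)"
      using elim ab by (intro powr_mono) auto
    then have "C * a powr \<Psi> l \<le> C * (a powr (B + \<Phi> l))"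
      using C by (rule mult_left_mono)
    also have "\<dots> = (C * a powr B * (a / b) powr \<Phi> l) * b powr \<Phi> l"
      using ab by (simp add: powr_add powr_divide)
    also have "\<dots> < c * b powr \<Phi> l"
      using elim ab by (intro mult_strict_right_mono) auto
    finally show ?case .
  qed
qed

theorem theorem2p4:
  fixes f :: "nat \<Rightarrow> nat \<Rightarrow> nat" and S E :: "nat set" and n :: nat
  assumes "admissible_weights f"
    and "S \<subseteq> {1..}" and "E = {1..} - S"
    and "1 \<in> S" and "3 \<in> S" and "2 \<in> E" and "4 \<in> E"
    and "n \<ge> 4" and "n mod 3 \<noteq> 1"
  shows "\<forall>\<^sub>F l in sequentially.
           (n mod 3 = 0 \<longrightarrow> Delta f E l n > 0) \<and>
           (n mod 3 = 2 \<longrightarrow> Delta f E l n < 0)"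
proof -
  have f1: "f l m \<ge> 1" and f11: "f l 1 = 1" if "l \<ge> 1" "m \<ge> 1" for l m
    using assms(1) that by (auto simp: admissible_weights_def)
  have "\<exists>\<Phi> \<Psi> :: nat \<Rightarrow> real.
      (\<forall>l\<ge>1. \<forall>n\<ge>1. real n powr \<Phi> l \<le> real (f l n) \<and> real (f l n) \<le> real n powr \<Psi> l) \<and>
      (\<exists>B>0. \<forall>l\<ge>1. 0 \<le> \<Psi> l - \<Phi> l \<and> \<Psi> l - \<Phi> l \<le> B) \<and>
      filterlim \<Phi> at_top sequentially"
    using assms(1) by (simp only: admissible_weights_def)
  then obtain \<Phi> \<Psi> :: "nat \<Rightarrow> real" and B
    where bounds: "\<forall>l\<ge>1. \<forall>n\<ge>1. real n powr \<Phi> l \<le> real (f l n) \<and> real (f l n) \<le> real n powr \<Psi> l"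
      and B: "\<forall>l\<ge>1. 0 \<le> \<Psi> l - \<Phi> l \<and> \<Psi> l - \<Phi> l \<le> B"
      and lim: "filterlim \<Phi> at_top sequentially"
    by (elim exE conjE)
  have lo: "real m powr \<Phi> l \<le> real (f l m)" and hi: "real (f l m) \<le> real m powr \<Psi> l"
    if "l \<ge> 1" "m \<ge> 1" for l m
    using bounds that by auto
  define p where "p = p_restricted f E"
  define M where "M = max_part_prod"
  define C where "C = (\<lambda>j. (real (j + 1) * real (j ^ j)) ^ (j + 1))"
  have C0: "C j \<ge> 0" for j by (simp add: C_def)
  have M1: "M j \<ge> 1" for j unfolding M_def by (rule max_part_prod_ge_1)
  have E13: "1 \<notin> E" "3 \<notin> E" using assms by auto
  have p0: "p l j \<ge> 0" for l j unfolding p_def by (rule p_restricted_nonneg)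
  \<comment> \<open>With \<open>\<Phi> l \<le> \<Psi> l\<close> this makes \<open>\<Psi> l\<close>
    nonnegative, as \<open>p_restricted_le\<close> requires.\<close>
  have \<Phi>0: "\<forall>\<^sub>F l in sequentially. \<Phi> l \<ge> 0" using lim by (simp add: filterlim_at_top)
  have l1: "\<forall>\<^sub>F l in sequentially. l \<ge> (1::nat)" by (rule eventually_ge_at_top)
  have upper: "\<forall>\<^sub>F l in sequentially. p l i * p l j \<le> C i * C j * (M i * M j) powr \<Psi> l" for i j
    using \<Phi>0 l1
  proof eventually_elim
    case (elim l)
    have "p l j \<le> C j * M j powr \<Psi> l" for j
      unfolding p_def C_def M_def
      using f1 hi elim B assms by (intro p_restricted_le) auto
    then have "p l i * p l j \<le> (C i * M i powr \<Psi> l) * (C j * M j powr \<Psi> l)"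
      using p0 C0 by (intro mult_mono) auto
    also have "\<dots> = C i * C j * (M i * M j) powr \<Psi> l"
      using M1[of i] M1[of j] by (simp add: powr_mult)
    finally show ?case .
  qed
  have lower: "\<forall>\<^sub>F l in sequentially. 1 / (real (i ^ i) * real (j ^ j)) * (3 ^ (i + j)) powr \<Phi> l
      \<le> p l (3 * i + r) * p l (3 * j + s)" for i j r s
    using l1
  proof eventually_elim
    case (elim l)
    have *: "(3 ^ i) powr \<Phi> l / real (i ^ i) \<le> p l (3 * i + r)" for i r
    proof -
      have "(3 ^ i) powr \<Phi> l = (3 powr \<Phi> l) ^ i"
        by (induction i) (auto simp: powr_mult)
      also have "\<dots> \<le> real (f l 3) ^ i"
        using lo[of l 3] elim by (intro power_mono) auto
      finally have "(3 ^ i) powr \<Phi> l / real (i ^ i) \<le> real (f l 3) ^ i / real (i ^ i)"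
        by (rule divide_right_mono) simp
      also have "\<dots> \<le> p l (3 * i + r)"
        unfolding p_def using E13 f11[of l 1] f1 elim by (intro p_restricted_ge) auto
      finally show ?thesis .
    qed
    have "(3 ^ i) powr \<Phi> l / real (i ^ i) * ((3 ^ j) powr \<Phi> l / real (j ^ j))
        \<le> p l (3 * i + r) * p l (3 * j + s)"
      using * p0 by (intro mult_mono) auto
    then show ?case by (simp add: power_add powr_mult)
  qed
  \<comment> \<open>Reduces both claims to an inequality between products of parts, free of
    \<open>l\<close>. The numbers \<open>r\<close> and \<open>s\<close> of ones do not affect the
    base on the right.\<close>
  have compare: "\<forall>\<^sub>F l in sequentially. p l i' * p l j' < p l (3 * i + r) * p l (3 * j + s)"
    if "M i' * M j' < 3 ^ (i + j)" for i j r s i' j'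
  proof -
    have "\<forall>\<^sub>F l in sequentially. \<Psi> l - \<Phi> l \<le> B"
      using l1 by eventually_elim (use B in auto)
    moreover have "1 \<le> M i' * M j'" using mult_mono[OF M1[of i'] M1[of j']] M1[of i'] by simp
    moreover have "real (x ^ x) > 0" for x by (cases "x = 0") auto
    then have "0 < 1 / (real (i ^ i) * real (j ^ j))"
      by (intro divide_pos_pos mult_pos_pos) simp_all
    ultimately have "\<forall>\<^sub>F l in sequentially. C i' * C j' * (M i' * M j') powr \<Psi> l
        < 1 / (real (i ^ i) * real (j ^ j)) * (3 ^ (i + j)) powr \<Phi> l"
      using that lim C0 by (intro eventually_powr_less) auto
    with upper[of i' j'] lower[of i j r s] show ?thesis
      by eventually_elim linarith
  qed
  define k where "k = n div 3"
  have "n = 3 * k + n mod 3" "n mod 3 < 3" by (simp_all add: k_def)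
  then consider "n = 3 * k" "k \<ge> 2" | "n = 3 * k + 2"
    using \<open>n \<ge> 4\<close> \<open>n mod 3 \<noteq> 1\<close> by linarith
  then show ?thesis
  proof cases
    case 1
    obtain i where i: "k = Suc i" using 1 by (cases k) auto
    have n: "n - 1 = 3 * i + 2" "n + 1 = 3 * Suc i + 1" using 1 i by auto
    \<comment> \<open>The left side is \<open>5/3 * 3 ^ i * 3 ^ Suc i\<close>, which is 5/9 of the
      right side.\<close>
    have "M (n - 1) * M (n + 1) < 3 ^ (k + k)"
      unfolding n M_def max_part_prod_eq i by (simp add: power_add)
    then have "\<forall>\<^sub>F l in sequentially. p l (n - 1) * p l (n + 1) < p l (3 * k + 0) * p l (3 * k + 0)"
      by (rule compare)
    then show ?thesis
      by eventually_elim (use 1 in \<open>simp add: Delta_def p_def power2_eq_square\<close>)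
  next
    case 2
    have n: "n - 1 = 3 * k + 1" "n + 1 = 3 * Suc k + 0" using 2 by auto
    \<comment> \<open>The left side is \<open>25/9 * 9 ^ k\<close>, the right side
      \<open>3 * 9 ^ k\<close>; the neighbours of \<open>n\<close> supply \<open>k\<close> and
      \<open>k + 1\<close> threes.\<close>
    have "M n * M n < 3 ^ (k + Suc k)"
      unfolding 2 M_def max_part_prod_eq by (simp add: power_add)
    then have "\<forall>\<^sub>F l in sequentially. p l n * p l n < p l (n - 1) * p l (n + 1)"
      unfolding n by (rule compare)
    moreover have "n mod 3 = 2" using 2 by presburger
    ultimately show ?thesis
      by (simp add: Delta_def p_def power2_eq_square)
  qed
qed

end
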